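(* Let $\mathbb{F}$ be a field, let $m\ge 1$, and let $\prec$ be a monomial ordering on the set of monomials in the variables $X_1,\dots,X_m$. Let $M_1\prec\cdots\prec M_t$ be monomials which are strictly consecutive in the following sense. - If $\mathbb{F}$ is infinite: for $i=1,\dots,t-1$ there is no monomial $L$ with $M_i\prec L\prec M_{i+1}$. - If $\mathbb{F}=\mathbb{F}_q$ is finite with $q$ elements: $\{M_1,\dots,M_t\}\subseteq\Box$, and for $i=1,\dots,t-1$ there is no monomial $L\in\Box$ with $M_i\prec L\prec M_{i+1}$ (monomials $L\notin\Box$ with $M_i\prec L\prec M_{i+1}$ are allowed). Let $1\le k\le t$ and put $$a:=\min\{\mu(M_{i_1},\dots,M_{i_{t-k+1}})\mid 1\le i_1<\cdots<i_{t-k+1}\le t\}.$$ Then for every $A\subseteq\mathbb{F}^m$ with $\#A<a$ there exist $k$ polynomials $F_1,\dots,F_k\in\mathbb{F}[X_1,\dots,X_m]$ with pairwise different leading monomials (with respect to $\prec$), all belonging to $\{M_1,\dots,M_t\}$, such that every element of $A$ is a common root of $F_1,\dots,F_k$. If $\mathbb{F}=\mathbb{F}_q$ is finite, then moreover: 1. the polynomials $F_1,\dots,F_k$ may be chosen with $\mathrm{Supp}(F_i)\subseteq\Box$ for $i=1,\dots,k$; 2. the result is sharp: there exists $A\subseteq\mathbb{F}_q^m$ with $\#A=a$ for which no such $k$ polynomials $F_1,\dots,F_k$ exist.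
   Context: A monomial is $X_1^{i_1}\cdots X_m^{i_m}$ with non-negative integer exponents. A monomial ordering is a total well-ordering on the monomials compatible with multiplication. The leading monomial of a non-zero polynomial is the $\prec$-largest monomial in its support. $\mathrm{Supp}(F)$ denotes the set of monomials appearing with non-zero coefficient in $F$. For monomials $N_1,\dots,N_s$ define $$\mu(N_1,\dots,N_s):=\#\{M\mid M\text{ is a monomial which divides some }N_i,\ i\in\{1,\dots,s\}\}.$$ When $\mathbb{F}=\mathbb{F}_q$ is the finite field with $q$ elements, define $$\Box:=\{X_1^{i_1}\cdots X_m^{i_m}\mid 0\le i_1,\dots,i_m\le q-1\}.$$ *)

theory Defs
  imports "HOL-Library.Poly_Mapping" "HOL-Library.Cardinality"
begin

(* Monomials are exponent vectors, written additively: multiplication of monomials is (+).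
   The variables are indexed by a type 'x, finite in all uses, so m = CARD('x) >= 1. *)
type_synonym 'x monomial = "'x \<Rightarrow>\<^sub>0 nat"

type_synonym ('x, 'a) mpoly = "'x monomial \<Rightarrow>\<^sub>0 'a"

definition monomial_ordering :: "('x monomial \<Rightarrow> 'x monomial \<Rightarrow> bool) \<Rightarrow> bool" where
  "monomial_ordering prec \<longleftrightarrow>
     irreflp prec \<and> transp prec \<and> totalp prec \<and> wfp prec \<and>
     (\<forall>K L N. prec K L \<longrightarrow> prec (K + N) (L + N))"

definition divides_mon :: "'x monomial \<Rightarrow> 'x monomial \<Rightarrow> bool" where
  "divides_mon L N \<longleftrightarrow> (\<exists>K. N = L + K)"

definition mu :: "'x monomial set \<Rightarrow> nat" where
  "mu S = card {L. \<exists>N\<in>S. divides_mon L N}"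

definition Box :: "nat \<Rightarrow> 'x monomial set" where
  "Box q = {L. \<forall>i. Poly_Mapping.lookup L i \<le> q - 1}"

definition Supp :: "('x, 'a::zero) mpoly \<Rightarrow> 'x monomial set" where
  "Supp F = Poly_Mapping.keys F"

(* Unspecified for F = 0. *)
definition lead_mon :: "('x monomial \<Rightarrow> 'x monomial \<Rightarrow> bool) \<Rightarrow> ('x, 'a::zero) mpoly \<Rightarrow> 'x monomial" where
  "lead_mon prec F = (THE L. L \<in> Supp F \<and> (\<forall>N\<in>Supp F. N \<noteq> L \<longrightarrow> prec N L))"

definition eval_mpoly :: "('x::finite, 'a::comm_semiring_1) mpoly \<Rightarrow> ('x \<Rightarrow> 'a) \<Rightarrow> 'a" where
  "eval_mpoly F x = (\<Sum>N\<in>Supp F. Poly_Mapping.lookup F N * (\<Prod>i\<in>UNIV. x i ^ Poly_Mapping.lookup N i))"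

definition vanishing_family ::
  "('x monomial \<Rightarrow> 'x monomial \<Rightarrow> bool) \<Rightarrow> 'x monomial set \<Rightarrow> ('x \<Rightarrow> 'a) set \<Rightarrow> nat
    \<Rightarrow> (nat \<Rightarrow> ('x::finite, 'a::field) mpoly) \<Rightarrow> bool" where
  "vanishing_family prec S A k F \<longleftrightarrow>
     (\<forall>i\<in>{1..k}. F i \<noteq> 0 \<and> lead_mon prec (F i) \<in> S) \<and>
     inj_on (\<lambda>i. lead_mon prec (F i)) {1..k} \<and>
     (\<forall>x\<in>A. \<forall>i\<in>{1..k}. eval_mpoly (F i) x = 0)"

end

theory Submission
  imports Defs "HOL-Library.FuncSet"
begin

text \<open>
  The footprint of \<open>A\<close> consists of the monomials that are not leading monomials of polynomials
  vanishing on \<open>A\<close>. Existence says that it is small, sharpness that some \<open>A\<close> makes it large.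

  Existence. Let \<open>B\<close> be the set of all monomials, or \<open>Box q\<close> over a field with \<open>q\<close> elements. In both
  cases every monomial agrees as a function with one of its divisors in \<open>B\<close>; for the box this is
  \<open>x ^ q = x\<close>. Two facts about the footprint of \<open>A\<close> inside \<open>B\<close> suffice. It has at most \<open>card A\<close>
  elements, since more monomials than points are linearly dependent as functions on \<open>A\<close>, and a
  dependency is a vanishing polynomial whose leading monomial is one of them
  (\<open>card_footprint_le\<close>). It is closed under divisors, since a vanishing polynomial can be multiplied
  by a monomial and then reduced to \<open>B\<close>, and its leading term survives the reduction
  (\<open>footprint_divisor_closed\<close>). If fewer than \<open>k\<close> of the \<open>M\<^sub>i\<close> were leading monomials, the footprint
  would contain \<open>t - k + 1\<close> of them and all their divisors, hence at least \<open>a\<close> elements, contrary to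
  \<open>card A < a\<close>.

  Sharpness. Let \<open>D\<close> be the set of divisors of \<open>t - k + 1\<close> of the \<open>M\<^sub>i\<close> that attain the minimum. Number
  the field elements and let \<open>A\<close> consist of the points whose tuple of numbers is the exponent vector of
  an element of \<open>D\<close>. A polynomial with leading monomial \<open>N \<in> D\<close> cannot vanish on \<open>A\<close>: the points below
  \<open>N\<close> form a grid with \<open>N\<^sub>i + 1\<close> values in coordinate \<open>i\<close>, and no other monomial of the polynomial is
  divisible by \<open>N\<close>, so the coefficient form of the Combinatorial Nullstellensatz
  (\<open>nonvanishing_on_grid\<close>) applies. The leading monomials of a vanishing family therefore lie among the
  remaining \<open>k - 1\<close> of the \<open>M\<^sub>i\<close>.
\<close>

section \<open>Divisibility and evaluation of monomials\<close>

lemma divides_mon_iff: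
  "divides_mon L N \<longleftrightarrow> (\<forall>i. Poly_Mapping.lookup L i \<le> Poly_Mapping.lookup N i)"
proof
  assume "\<forall>i. Poly_Mapping.lookup L i \<le> Poly_Mapping.lookup N i"
  then have "N = L + (N - L)"
    by (intro poly_mapping_eqI) (simp add: lookup_add lookup_minus)
  then show "divides_mon L N"
    unfolding divides_mon_def by blast
qed (auto simp: divides_mon_def lookup_add)

lemma divides_mon_refl: "divides_mon N N"
  by (simp add: divides_mon_iff)

lemma divides_mon_Box: "divides_mon L N \<Longrightarrow> N \<in> Box q \<Longrightarrow> L \<in> Box q"
  unfolding divides_mon_iff Box_def using order_trans by blast

lemma finite_Box: "finite (Box q :: 'x::finite monomial set)"
proof -
  have "Poly_Mapping.lookup ` (Box q :: 'x monomial set) \<subseteq> PiE UNIV (\<lambda>_. {..q - 1})"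
    by (auto simp: Box_def)
  then have "finite (Poly_Mapping.lookup ` (Box q :: 'x monomial set))"
    by (rule finite_subset) (simp add: finite_PiE)
  then show ?thesis
    by (rule finite_imageD) (auto intro: inj_onI poly_mapping_eqI)
qed

definition mon_eval :: "'x::finite monomial \<Rightarrow> ('x \<Rightarrow> 'a::comm_semiring_1) \<Rightarrow> 'a" where
  "mon_eval N x = (\<Prod>i\<in>UNIV. x i ^ Poly_Mapping.lookup N i)"

lemma mon_eval_add: "mon_eval (K + L) x = mon_eval K x * mon_eval L x"
  by (simp add: mon_eval_def lookup_add power_add prod.distrib)

lemma eval_mpoly_superset:
  assumes "finite S" and "Supp F \<subseteq> S"
  shows "eval_mpoly F x = (\<Sum>N\<in>S. Poly_Mapping.lookup F N * mon_eval N x)"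
  unfolding eval_mpoly_def mon_eval_def
  using assms by (intro sum.mono_neutral_left) (auto simp: Supp_def in_keys_iff)

lemma Supp_sum_single:
  "Supp (\<Sum>N\<in>S. Poly_Mapping.single (g N) (c N)) \<subseteq> g ` S"
proof -
  have "Poly_Mapping.keys (\<Sum>N\<in>S. Poly_Mapping.single (g N) (c N))
      \<subseteq> (\<Union>N\<in>S. Poly_Mapping.keys (Poly_Mapping.single (g N) (c N)))"
    by (rule keys_sum)
  also have "\<dots> \<subseteq> g ` S"
    by (auto split: if_splits)
  finally show ?thesis
    by (simp add: Supp_def)
qed

lemma eval_mpoly_sum_single:
  fixes c :: "'n \<Rightarrow> 'a::comm_semiring_1" and g :: "'n \<Rightarrow> 'x::finite monomial"
  assumes "finite S"
  shows "eval_mpoly (\<Sum>N\<in>S. Poly_Mapping.single (g N) (c N)) x = (\<Sum>N\<in>S. c N * mon_eval (g N) x)"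
proof -
  have "eval_mpoly (\<Sum>N\<in>S. Poly_Mapping.single (g N) (c N)) x
      = (\<Sum>K\<in>g ` S. (\<Sum>N\<in>S. if K = g N then c N * mon_eval K x else 0))"
    using assms
    by (auto simp: eval_mpoly_superset[OF _ Supp_sum_single] lookup_sum lookup_single when_def
        sum_distrib_right intro!: sum.cong)
  also have "\<dots> = (\<Sum>N\<in>S. (\<Sum>K\<in>g ` S. if K = g N then c N * mon_eval K x else 0))"
    by (rule sum.swap)
  also have "\<dots> = (\<Sum>N\<in>S. c N * mon_eval (g N) x)"
    using assms by (simp add: sum.delta)
  finally show ?thesis .
qed

section \<open>Leading monomials\<close>

context
  fixes prec :: "'x::finite monomial \<Rightarrow> 'x monomial \<Rightarrow> bool"
  assumes mo: "monomial_ordering prec"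
begin

lemma prec_irrefl: "\<not> prec N N"
  using mo by (auto simp: monomial_ordering_def dest: irreflpD)

lemma prec_trans: "prec K L \<Longrightarrow> prec L N \<Longrightarrow> prec K N"
  using mo by (auto simp: monomial_ordering_def dest: transpD)

lemma prec_add: "prec K L \<Longrightarrow> prec (K + N) (L + N)"
  using mo by (auto simp: monomial_ordering_def)

lemma prec_total: "K \<noteq> L \<Longrightarrow> prec K L \<or> prec L K"
  using mo by (auto simp: monomial_ordering_def dest: totalpD)

text \<open>
  If something lay below the monomial \<open>1\<close> (the zero exponent vector), then so would a minimal
  such \<open>N\<close>, and its square would be smaller still.
\<close>
lemma not_prec_zero: "\<not> prec K 0"
proof
  assume K: "prec K 0"
  have "\<exists>N\<in>{N. prec N 0}. \<forall>L. prec L N \<longrightarrow> L \<notin> {N. prec N 0}"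
    using mo K unfolding monomial_ordering_def wfp_iff_ex_minimal
    by (elim conjE) (drule spec[of _ "{N. prec N 0}"], auto)
  then obtain N where N: "prec N 0" and min: "\<And>L. prec L N \<Longrightarrow> \<not> prec L 0"
    by blast
  have "prec (N + N) N"
    using prec_add[OF N, of N] by simp
  with min N show False
    using prec_trans[of "N + N" N 0] by simp
qed

lemma divides_mon_prec:
  assumes "divides_mon L N"
  shows "L = N \<or> prec L N"
proof -
  obtain K where K: "N = L + K"
    using assms by (auto simp: divides_mon_def)
  show ?thesis
  proof (cases "K = 0")
    case False
    then have "prec 0 K"
      using prec_total not_prec_zero by blast
    then show ?thesis
      using prec_add[of 0 K L] by (simp add: K add.commute)
  qed (simp add: K)
qed

lemma lead_mon_eqI:
  assumes "L \<in> Supp F" and "\<And>N. N \<in> Supp F \<Longrightarrow> N \<noteq> L \<Longrightarrow> prec N L"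
  shows "lead_mon prec F = L"
  unfolding lead_mon_def
proof (rule the_equality)
  show "L \<in> Supp F \<and> (\<forall>N\<in>Supp F. N \<noteq> L \<longrightarrow> prec N L)"
    using assms by simp
next
  fix K
  assume "K \<in> Supp F \<and> (\<forall>N\<in>Supp F. N \<noteq> K \<longrightarrow> prec N K)"
  then show "K = L"
    using assms prec_trans[of K L K] prec_irrefl[of K] by metis
qed

lemma lead_mon_exists:
  assumes "F \<noteq> 0"
  shows "lead_mon prec F \<in> Supp F"
    and "N \<in> Supp F \<Longrightarrow> N \<noteq> lead_mon prec F \<Longrightarrow> prec N (lead_mon prec F)"
proof -
  have "\<exists>L\<in>Supp F. \<forall>N\<in>Supp F. N \<noteq> L \<longrightarrow> \<not> prec L N"
  proof (rule Finite_Set.bex_max_element)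
    show "transp_on (Supp F) prec"
      by (rule transp_onI) (rule prec_trans)
    show "asymp_on (Supp F) prec"
      by (rule asymp_onI) (metis prec_trans prec_irrefl)
  qed (use assms in \<open>auto simp: Supp_def\<close>)
  then obtain L where "L \<in> Supp F" "\<forall>N\<in>Supp F. N \<noteq> L \<longrightarrow> \<not> prec L N"
    by blast
  then have L: "L \<in> Supp F" "\<And>N. N \<in> Supp F \<Longrightarrow> N \<noteq> L \<Longrightarrow> prec N L"
    using prec_total by auto
  then have "lead_mon prec F = L"
    by (rule lead_mon_eqI)
  with L show "lead_mon prec F \<in> Supp F"
    and "N \<in> Supp F \<Longrightarrow> N \<noteq> lead_mon prec F \<Longrightarrow> prec N (lead_mon prec F)"
    by auto
qed

end

section \<open>The footprint of a finite point set\<close>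

text \<open>Gaussian elimination: a homogeneous system with more unknowns than equations.\<close>

lemma nontrivial_combination_vanishing:
  fixes v :: "'n \<Rightarrow> 'p \<Rightarrow> 'a::field"
  assumes "finite A" and "finite S" and "card A < card S"
  shows "\<exists>c. (\<exists>N\<in>S. c N \<noteq> 0) \<and> (\<forall>x\<in>A. (\<Sum>N\<in>S. c N * v N x) = 0)"
  using assms
proof (induction A arbitrary: S v rule: finite_induct)
  case empty
  then show ?case
    by (intro exI[of _ "\<lambda>_. 1"]) (auto simp: card_gt_0_iff)
next
  case (insert y A)
  show ?case
  proof (cases "\<forall>N\<in>S. v N y = 0")
    case True
    then show ?thesis
      using insert.IH[of S v] insert.prems insert.hyps by auto
  next
    case False
    then obtain P where P: "P \<in> S" "v P y \<noteq> 0"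
      by blast
    let ?T = "S - {P}"
    define w where "w N x = v N x - v N y / v P y * v P x" for N x
    have "card A < card ?T"
      using insert.prems insert.hyps P by (simp add: card_Diff_singleton)
    then obtain c where c: "\<exists>N\<in>?T. c N \<noteq> 0" "\<forall>x\<in>A. (\<Sum>N\<in>?T. c N * w N x) = 0"
      using insert.IH[of ?T w] insert.prems by blast
    define d where "d = (\<Sum>N\<in>?T. c N * (v N y / v P y))"
    let ?c = "c(P := - d)"
    have eq: "(\<Sum>N\<in>S. ?c N * v N x) = (\<Sum>N\<in>?T. c N * w N x)" for x
    proof -
      have "(\<Sum>N\<in>S. ?c N * v N x) = - d * v P x + (\<Sum>N\<in>?T. c N * v N x)"
        using insert.prems P by (subst sum.remove[of S P]) (auto intro!: sum.cong)
      also have "\<dots> = (\<Sum>N\<in>?T. c N * w N x)"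
        by (simp add: d_def w_def sum_distrib_right right_diff_distrib sum_subtractf mult.assoc)
      finally show ?thesis .
    qed
    have "w N y = 0" for N
      using P by (simp add: w_def)
    then have "\<forall>x\<in>insert y A. (\<Sum>N\<in>S. ?c N * v N x) = 0"
      unfolding eq using c(2) by simp
    moreover have "\<exists>N\<in>S. ?c N \<noteq> 0"
      using c(1) by auto
    ultimately show ?thesis
      by blast
  qed
qed

definition leading_on ::
  "('x monomial \<Rightarrow> 'x monomial \<Rightarrow> bool) \<Rightarrow> 'x monomial set \<Rightarrow> ('x::finite \<Rightarrow> 'a::field) set
    \<Rightarrow> 'x monomial \<Rightarrow> ('x, 'a) mpoly \<Rightarrow> bool" where
  "leading_on prec B A N F \<longleftrightarrow>
     F \<noteq> 0 \<and> Supp F \<subseteq> B \<and> lead_mon prec F = N \<and> (\<forall>x\<in>A. eval_mpoly F x = 0)"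

definition footprint ::
  "('x monomial \<Rightarrow> 'x monomial \<Rightarrow> bool) \<Rightarrow> 'x monomial set \<Rightarrow> ('x::finite \<Rightarrow> 'a::field) set
    \<Rightarrow> 'x monomial set" where
  "footprint prec B A = {N \<in> B. \<not> (\<exists>F. leading_on prec B A N F)}"

text \<open>
  More than \<open>card A\<close> monomials satisfy a linear relation on \<open>A\<close>, and the leading monomial of that
  relation is one of them, so they cannot all lie in the footprint.
\<close>
lemma card_footprint_le:
  fixes A :: "('x::finite \<Rightarrow> 'a::field) set"
  assumes mo: "monomial_ordering prec" and A: "finite A"
  shows "finite (footprint prec B A)" and "card (footprint prec B A) \<le> card A"
proof -
  have le: "card S \<le> card A" if S: "finite S" "S \<subseteq> footprint prec B A" for S
  proof (rule ccontr)
    assume "\<not> card S \<le> card A"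
    then obtain c :: "'x monomial \<Rightarrow> 'a"
      where c: "\<exists>N\<in>S. c N \<noteq> 0" "\<forall>x\<in>A. (\<Sum>N\<in>S. c N * mon_eval N x) = 0"
      using nontrivial_combination_vanishing[OF A S(1), of mon_eval] by auto
    define F where "F = (\<Sum>N\<in>S. Poly_Mapping.single N (c N))"
    have supp: "Supp F \<subseteq> S"
      using Supp_sum_single[of "\<lambda>N. N" c S] by (simp add: F_def)
    obtain N where "N \<in> S" "c N \<noteq> 0"
      using c(1) by blast
    then have "Poly_Mapping.lookup F N \<noteq> 0"
      using S(1) by (simp add: F_def lookup_sum lookup_single when_def sum.delta)
    then have "F \<noteq> 0"
      by auto
    moreover have "eval_mpoly F x = 0" if "x \<in> A" for x
      using eval_mpoly_sum_single[OF S(1), of "\<lambda>N. N" c x] c(2) that by (simp add: F_def)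
    moreover have "Supp F \<subseteq> B"
      using supp S(2) by (auto simp: footprint_def)
    ultimately have "leading_on prec B A (lead_mon prec F) F"
      by (simp add: leading_on_def)
    moreover have "lead_mon prec F \<in> footprint prec B A"
      using lead_mon_exists(1)[OF mo \<open>F \<noteq> 0\<close>] supp S(2) by blast
    ultimately show False
      by (auto simp: footprint_def)
  qed
  show fin: "finite (footprint prec B A)"
  proof (rule ccontr)
    assume "infinite (footprint prec B A)"
    then obtain S where "finite S" "card S = Suc (card A)" "S \<subseteq> footprint prec B A"
      using infinite_arbitrarily_large by blast
    with le[of S] show False
      by simp
  qed
  show "card (footprint prec B A) \<le> card A"
    using le[OF fin] by blast
qed

text \<open>
  Reduction to \<open>B\<close> may only pass to divisors, so that it never moves a monomial upwards in any monomial
  ordering. The type argument names the field over which the two monomials agree as functions.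
\<close>
definition reduces_to :: "'a::field itself \<Rightarrow> 'x::finite monomial set \<Rightarrow> bool" where
  "reduces_to _ B \<longleftrightarrow> (\<forall>N\<in>B. \<forall>L. divides_mon L N \<longrightarrow> L \<in> B) \<and>
     (\<forall>N. \<exists>N'\<in>B. divides_mon N' N \<and> (\<forall>x :: 'x \<Rightarrow> 'a. mon_eval N' x = mon_eval N x))"

text \<open>
  If \<open>F\<close> vanishes on \<open>A\<close> and has leading monomial \<open>L\<close>, then multiplying \<open>F\<close> by the monomial \<open>N / L\<close> and
  reducing to \<open>B\<close> gives leading monomial \<open>N\<close>: the other terms start below \<open>N\<close> and reduction only lowers
  them.
\<close>
lemma footprint_divisor_closed:
  fixes A :: "('x::finite \<Rightarrow> 'a::field) set"
  assumes mo: "monomial_ordering prec" and B: "reduces_to TYPE('a) B"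
    and N: "N \<in> footprint prec B A" and L: "divides_mon L N"
  shows "L \<in> footprint prec B A"
proof (rule ccontr)
  assume notin: "L \<notin> footprint prec B A"
  have NB: "N \<in> B"
    using N by (simp add: footprint_def)
  then have "L \<in> B"
    using B L by (auto simp: reduces_to_def)
  then obtain F where F: "F \<noteq> 0" "Supp F \<subseteq> B" "lead_mon prec F = L" "\<forall>x\<in>A. eval_mpoly F x = 0"
    using notin by (auto simp: footprint_def leading_on_def)
  obtain D where D: "N = L + D"
    using L by (auto simp: divides_mon_def)
  \<comment> \<open>The reduction must fix \<open>B\<close> pointwise, so that the leading term \<open>N\<close> survives.\<close>
  have "\<exists>K'. K' \<in> B \<and> divides_mon K' K \<and> (\<forall>x :: 'x \<Rightarrow> 'a. mon_eval K' x = mon_eval K x)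
      \<and> (K \<in> B \<longrightarrow> K' = K)" for K
    using B divides_mon_refl[of K] unfolding reduces_to_def by metis
  then obtain red where red: "\<And>K. red K \<in> B" "\<And>K. divides_mon (red K) K"
      "\<And>K (x :: 'x \<Rightarrow> 'a). mon_eval (red K) x = mon_eval K x" "\<And>K. K \<in> B \<Longrightarrow> red K = K"
    by metis
  define G where
    "G = (\<Sum>K\<in>Supp F. Poly_Mapping.single (red (K + D)) (Poly_Mapping.lookup F K))"
  have fin: "finite (Supp F)"
    by (simp add: Supp_def)
  have supp: "Supp G \<subseteq> (\<lambda>K. red (K + D)) ` Supp F"
    unfolding G_def by (rule Supp_sum_single)
  have LF: "L \<in> Supp F"
    using lead_mon_exists(1)[OF mo F(1)] F(3) by simp
  have below: "prec (red (K + D)) N" if "K \<in> Supp F" "K \<noteq> L" for K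
  proof -
    have "prec (K + D) N"
      unfolding D using lead_mon_exists(2)[OF mo F(1)] F(3) that by (intro prec_add[OF mo]) blast
    then show ?thesis
      using divides_mon_prec[OF mo red(2)[of "K + D"]] prec_trans[OF mo] by metis
  qed
  have redN: "red (L + D) = N"
    using red(4)[OF NB] by (simp add: D)
  have "Poly_Mapping.lookup G N = (\<Sum>K\<in>Supp F. if K = L then Poly_Mapping.lookup F K else 0)"
    unfolding G_def lookup_sum lookup_single when_def
    using below prec_irrefl[OF mo] redN by (intro sum.cong refl) (metis (full_types))
  also have "\<dots> = Poly_Mapping.lookup F L"
    using LF fin by (simp add: sum.delta)
  finally have NG: "N \<in> Supp G"
    using LF by (simp add: Supp_def in_keys_iff)
  have "lead_mon prec G = N"
    using NG supp below redN by (intro lead_mon_eqI[OF mo]) (auto)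
  moreover have "G \<noteq> 0"
    using NG by (auto simp: Supp_def)
  moreover have "Supp G \<subseteq> B"
    using supp red(1) by blast
  moreover have "eval_mpoly G x = 0" if "x \<in> A" for x
  proof -
    have "eval_mpoly G x = (\<Sum>K\<in>Supp F. Poly_Mapping.lookup F K * mon_eval K x) * mon_eval D x"
      unfolding G_def eval_mpoly_sum_single[OF fin] red(3) mon_eval_add
      by (simp add: sum_distrib_right mult.assoc)
    also have "\<dots> = 0"
      using F(4) that eval_mpoly_superset[OF fin, of F x] by simp
    finally show ?thesis .
  qed
  ultimately have "leading_on prec B A N G"
    by (simp add: leading_on_def)
  with N show False
    by (auto simp: footprint_def)
qed

section \<open>Reduction to the box over a finite field\<close>

lemma field_power_card:
  fixes x :: "'a::field"
  assumes fin: "finite (UNIV :: 'a set)"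
  shows "x ^ CARD('a) = x"
proof (cases "x = 0")
  case False
  let ?U = "UNIV - {0 :: 'a}"
  have "inj_on ((*) x) ?U"
    using False by (auto intro: inj_onI)
  moreover have "(*) x ` ?U = ?U"
  proof (rule endo_inj_surj)
    show "inj_on ((*) x) ?U" by fact
  qed (use fin False in auto)
  ultimately have "prod (\<lambda>y. y) ?U = prod (\<lambda>y. x * y) ?U"
    using prod.reindex[of "(*) x" ?U "\<lambda>y. y"] by simp
  also have "\<dots> = x ^ card ?U * prod (\<lambda>y. y) ?U"
    by (simp add: prod.distrib)
  finally have "x ^ card ?U = 1"
    using fin by simp
  moreover have "CARD('a) = Suc (card ?U)"
    by (rule card.remove[OF fin UNIV_I])
  ultimately show ?thesis
    by (simp only: power_Suc mult_1_right)
qed (use fin in \<open>simp add: zero_power card_gt_0_iff\<close>)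

text \<open>Lowering an exponent by \<open>q - 1\<close> is harmless as long as it stays positive.\<close>

lemma field_power_reduce:
  assumes fin: "finite (UNIV :: 'a::field set)"
  shows "\<exists>e'\<le>e. e' \<le> CARD('a) - 1 \<and> (\<forall>x :: 'a. x ^ e' = x ^ e)"
proof (induction e rule: less_induct)
  case (less e)
  show ?case
  proof (cases "e \<le> CARD('a) - 1")
    case False
    have "card {0, 1 :: 'a} \<le> CARD('a)"
      using fin by (intro card_mono) auto
    then have q: "2 \<le> CARD('a)"
      by simp
    define d where "d = e - CARD('a)"
    have d: "e = d + CARD('a)"
      using False by (simp add: d_def)
    obtain e' where e': "e' \<le> d + 1" "e' \<le> CARD('a) - 1" "\<forall>x :: 'a. x ^ e' = x ^ (d + 1)"
      using less.IH[of "d + 1"] d q by auto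
    have "x ^ (d + 1) = x ^ e" for x :: 'a
      by (simp add: d power_add field_power_card[OF fin])
    then show ?thesis
      using e' d q by (intro exI[of _ e']) auto
  qed blast
qed

lemma reduces_to_Box:
  assumes fin: "finite (UNIV :: 'a::field set)"
  shows "reduces_to TYPE('a) (Box CARD('a) :: 'x::finite monomial set)"
  unfolding reduces_to_def
proof (intro conjI ballI allI impI)
  fix L N :: "'x monomial"
  assume "N \<in> Box CARD('a)" and "divides_mon L N"
  then show "L \<in> Box CARD('a)"
    by (rule divides_mon_Box[rotated])
next
  fix N :: "'x monomial"
  obtain f where f: "\<And>e. f e \<le> e" "\<And>e. f e \<le> CARD('a) - 1" "\<And>e (x :: 'a). x ^ f e = x ^ e"
    using field_power_reduce[OF fin] by metis
  define N' where "N' = Abs_poly_mapping (\<lambda>i. f (Poly_Mapping.lookup N i))"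
  have "Poly_Mapping.lookup N' i = f (Poly_Mapping.lookup N i)" for i
    by (simp add: N'_def)
  then have "N' \<in> Box CARD('a) \<and> divides_mon N' N \<and> (\<forall>x :: 'x \<Rightarrow> 'a. mon_eval N' x = mon_eval N x)"
    using f by (auto simp: Box_def divides_mon_iff mon_eval_def)
  then show "\<exists>N'\<in>Box CARD('a). divides_mon N' N \<and> (\<forall>x :: 'x \<Rightarrow> 'a. mon_eval N' x = mon_eval N x)"
    by blast
qed

lemma reduces_to_UNIV: "reduces_to TYPE('a::field) (UNIV :: 'x::finite monomial set)"
  unfolding reduces_to_def using divides_mon_refl by blast

section \<open>Existence of vanishing families\<close>

lemma vanishing_family_exists:
  fixes A :: "('x::finite \<Rightarrow> 'a::field) set" and M :: "nat \<Rightarrow> 'x monomial"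
  assumes mo: "monomial_ordering prec" and B: "reduces_to TYPE('a) B"
    and MB: "M ` {1..t} \<subseteq> B" and inj: "inj_on M {1..t}"
    and A: "finite A" and k: "k \<le> t"
    and large: "\<And>I. I \<subseteq> {1..t} \<Longrightarrow> card I = t - k + 1 \<Longrightarrow> card A < mu (M ` I)"
  shows "\<exists>F. vanishing_family prec (M ` {1..t}) A k F \<and> (\<forall>i\<in>{1..k}. Supp (F i) \<subseteq> B)"
proof -
  define J where "J = {i \<in> {1..t}. M i \<in> footprint prec B A}"
  have "card J < t - k + 1"
  proof (rule ccontr)
    assume "\<not> card J < t - k + 1"
    then obtain I where I: "I \<subseteq> J" "card I = t - k + 1"
      using obtain_subset_with_card_n[of "t - k + 1" J] by auto
    have "{L. \<exists>N\<in>M ` I. divides_mon L N} \<subseteq> footprint prec B A"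
      using footprint_divisor_closed[OF mo B] I(1) by (auto simp: J_def)
    then have "mu (M ` I) \<le> card (footprint prec B A)"
      unfolding mu_def by (rule card_mono[OF card_footprint_le(1)[OF mo A]])
    also have "\<dots> \<le> card A"
      by (rule card_footprint_le(2)[OF mo A])
    finally have "mu (M ` I) \<le> card A" .
    moreover have "I \<subseteq> {1..t}"
      using I(1) by (auto simp: J_def)
    ultimately show False
      using large[OF _ I(2)] by simp
  qed
  moreover have "card ({1..t} - J) = t - card J"
    by (subst card_Diff_subset) (auto simp: J_def)
  ultimately have "k \<le> card ({1..t} - J)"
    using k by simp
  then obtain K where K: "K \<subseteq> {1..t} - J" "card K = k" "finite K"
    using obtain_subset_with_card_n by blast
  then obtain g where g: "bij_betw g {1..k} K"
    using finite_same_card_bij[of "{1..k}" K] by auto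
  have gK: "g i \<in> {1..t} - J" if "i \<in> {1..k}" for i
    using bij_betwE[OF g] K(1) that by blast
  have "\<exists>F. leading_on prec B A (M (g i)) F" if "i \<in> {1..k}" for i
  proof -
    have "M (g i) \<in> B" "M (g i) \<notin> footprint prec B A"
      using gK[OF that] MB by (blast, simp add: J_def)
    then show ?thesis
      by (simp add: footprint_def)
  qed
  then obtain F where F: "\<And>i. i \<in> {1..k} \<Longrightarrow> leading_on prec B A (M (g i)) (F i)"
    by metis
  have "inj_on M (g ` {1..k})"
    using inj gK by (blast intro: inj_on_subset)
  then have injMg: "inj_on (\<lambda>i. M (g i)) {1..k}"
    using comp_inj_on[OF bij_betw_imp_inj_on[OF g]] by (simp add: comp_def)
  have lead: "lead_mon prec (F i) = M (g i)" if "i \<in> {1..k}" for i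
    using F[OF that] by (simp add: leading_on_def)
  have "inj_on (\<lambda>i. lead_mon prec (F i)) {1..k}"
    using injMg by (rule inj_on_cong[THEN iffD2, rotated]) (rule lead)
  moreover have "F i \<noteq> 0 \<and> lead_mon prec (F i) \<in> M ` {1..t}" if "i \<in> {1..k}" for i
    using F[OF that] gK[OF that] unfolding leading_on_def by blast
  moreover have "eval_mpoly (F i) x = 0" if "i \<in> {1..k}" "x \<in> A" for i x
    using F[OF that(1)] that(2) by (simp add: leading_on_def)
  ultimately have "vanishing_family prec (M ` {1..t}) A k F"
    unfolding vanishing_family_def by blast
  moreover have "\<forall>i\<in>{1..k}. Supp (F i) \<subseteq> B"
    using F by (auto simp: leading_on_def)
  ultimately show ?thesis
    by blast
qed

section \<open>Nonvanishing on a grid\<close>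

text \<open>
  The weights are those of the divided difference at the nodes \<open>S\<close>, a linear functional that reads off
  the coefficient of degree \<open>n\<close> of a polynomial of degree at most \<open>n\<close>. Adding a node \<open>b\<close> amounts to
  applying the old functional to the difference quotient \<open>(f s - f b) / (s - b)\<close>.
\<close>
lemma divided_difference_weights:
  fixes S :: "'a::field set"
  assumes "finite S" and "card S = Suc n"
  shows "\<exists>w. \<forall>j\<le>n. (\<Sum>s\<in>S. w s * s ^ j) = (if j = n then 1 else 0)"
  using assms
proof (induction n arbitrary: S)
  case 0
  then obtain s where "S = {s}"
    by (auto simp: card_Suc_eq)
  then show ?case
    by (intro exI[of _ "\<lambda>_. 1"]) auto
next
  case (Suc n)
  then obtain b T where S: "S = insert b T" "b \<notin> T" "card T = Suc n" and T: "finite T"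
    by (metis card_Suc_eq finite_insert)
  obtain v where v: "\<forall>j\<le>n. (\<Sum>s\<in>T. v s * s ^ j) = (if j = n then 1 else 0)"
    using Suc.IH[OF T S(3)] by blast
  define w where "w s = (if s = b then - (\<Sum>r\<in>T. v r / (r - b)) else v s / (s - b))" for s
  have "(\<Sum>s\<in>S. w s * s ^ j) = (if j = Suc n then 1 else 0)" if j: "j \<le> Suc n" for j
  proof -
    have "(\<Sum>s\<in>S. w s * s ^ j) = w b * b ^ j + (\<Sum>s\<in>T. w s * s ^ j)"
      using S T by simp
    also have "(\<Sum>s\<in>T. w s * s ^ j) = (\<Sum>s\<in>T. v s / (s - b) * s ^ j)"
      using S by (intro sum.cong) (auto simp: w_def)
    also have "w b * b ^ j + \<dots> = (\<Sum>s\<in>T. v s / (s - b) * (s ^ j - b ^ j))"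
      by (simp add: w_def sum_distrib_right right_diff_distrib sum_subtractf)
    also have "\<dots> = (\<Sum>s\<in>T. \<Sum>i<j. b ^ (j - Suc i) * (v s * s ^ i))"
    proof (intro sum.cong refl)
      fix s assume "s \<in> T"
      then have "s - b \<noteq> 0"
        using S by auto
      then have "v s / (s - b) * (s ^ j - b ^ j) = v s * (\<Sum>i<j. b ^ (j - Suc i) * s ^ i)"
        by (simp add: power_diff_sumr2[of s j b])
      then show "v s / (s - b) * (s ^ j - b ^ j) = (\<Sum>i<j. b ^ (j - Suc i) * (v s * s ^ i))"
        by (simp add: sum_distrib_left mult_ac)
    qed
    also have "\<dots> = (\<Sum>i<j. b ^ (j - Suc i) * (\<Sum>s\<in>T. v s * s ^ i))"
      by (subst sum.swap) (simp add: sum_distrib_left)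
    also have "\<dots> = (\<Sum>i<j. b ^ (j - Suc i) * (if i = n then 1 else 0))"
      using v j by (intro sum.cong) auto
    also have "\<dots> = (\<Sum>i<j. if i = n then b ^ (j - Suc n) else 0)"
      by (intro sum.cong) auto
    also have "\<dots> = (if j = Suc n then 1 else 0)"
      using j by (auto simp: sum.delta)
    finally show ?thesis .
  qed
  then show ?case
    by blast
qed

text \<open>
  Applying the divided difference in each coordinate sends \<open>X ^ N\<close> to \<open>1\<close>, and sends to \<open>0\<close> every
  monomial with some exponent below that of \<open>N\<close>.
\<close>
lemma nonvanishing_on_grid:
  fixes F :: "('x::finite, 'a::field) mpoly" and S :: "'x \<Rightarrow> 'a set"
  assumes N: "N \<in> Supp F" and max: "\<And>K. K \<in> Supp F \<Longrightarrow> K \<noteq> N \<Longrightarrow> \<not> divides_mon N K"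
    and S: "\<And>i. finite (S i)" "\<And>i. card (S i) = Suc (Poly_Mapping.lookup N i)"
  shows "\<exists>x. (\<forall>i. x i \<in> S i) \<and> eval_mpoly F x \<noteq> 0"
proof (rule ccontr)
  assume vanish: "\<not> ?thesis"
  have "\<forall>i. \<exists>w. \<forall>j\<le>Poly_Mapping.lookup N i.
      (\<Sum>s\<in>S i. w s * s ^ j) = (if j = Poly_Mapping.lookup N i then 1 else 0)"
    using divided_difference_weights[OF S] by blast
  then obtain w where w: "\<And>i j. j \<le> Poly_Mapping.lookup N i \<Longrightarrow>
      (\<Sum>s\<in>S i. w i s * s ^ j) = (if j = Poly_Mapping.lookup N i then 1 else 0)"
    by metis
  define W where "W x = (\<Prod>i\<in>UNIV. w i (x i))" for x
  have tensor: "(\<Sum>x\<in>PiE UNIV S. W x * mon_eval K x)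
      = (\<Prod>i\<in>UNIV. \<Sum>s\<in>S i. w i s * s ^ Poly_Mapping.lookup K i)" for K
    unfolding W_def mon_eval_def using S(1)
    by (simp add: prod_sum_PiE prod.distrib)
  have kill: "(\<Sum>x\<in>PiE UNIV S. W x * mon_eval K x) = (if K = N then 1 else 0)"
    if K: "K \<in> Supp F" for K
  proof (cases "K = N")
    case False
    then obtain i where "Poly_Mapping.lookup K i < Poly_Mapping.lookup N i"
      using max[OF K] by (auto simp: divides_mon_iff not_le)
    then have "(\<Sum>s\<in>S i. w i s * s ^ Poly_Mapping.lookup K i) = 0"
      using w[of "Poly_Mapping.lookup K i" i] by simp
    then show ?thesis
      unfolding tensor using False by (auto intro!: prod_zero)
  qed (simp add: tensor w)
  have fin: "finite (Supp F)"
    by (simp add: Supp_def)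
  have "0 = (\<Sum>x\<in>PiE UNIV S. W x * eval_mpoly F x)"
    using vanish by (intro sum.neutral[symmetric]) auto
  also have "\<dots> = (\<Sum>x\<in>PiE UNIV S. \<Sum>K\<in>Supp F. Poly_Mapping.lookup F K * (W x * mon_eval K x))"
    by (simp add: eval_mpoly_superset[OF fin order_refl] sum_distrib_left mult_ac)
  also have "\<dots> = (\<Sum>K\<in>Supp F. Poly_Mapping.lookup F K * (\<Sum>x\<in>PiE UNIV S. W x * mon_eval K x))"
    by (subst sum.swap) (simp add: sum_distrib_left)
  also have "\<dots> = (\<Sum>K\<in>Supp F. if K = N then Poly_Mapping.lookup F K else 0)"
    by (intro sum.cong refl) (simp add: kill)
  also have "\<dots> = Poly_Mapping.lookup F N"
    using N fin by (simp add: sum.delta)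
  finally show False
    using N by (simp add: Supp_def in_keys_iff)
qed

section \<open>Point sets modelled on sets of monomials\<close>

text \<open>
  The divisors of the leading monomial \<open>N\<close> correspond to a full grid of points, all of them in the point
  set because \<open>D\<close> is closed under divisors. A proper multiple of \<open>N\<close> would lie above \<open>N\<close>, so none
  occurs in \<open>F\<close>, and \<open>F\<close> cannot vanish on that grid.
\<close>
lemma lead_mon_not_in_grid:
  fixes F :: "('x::finite, 'a::field) mpoly"
  assumes mo: "monomial_ordering prec" and F: "F \<noteq> 0"
    and h: "inj_on h {0..<q}" and box: "D \<subseteq> Box q" and q: "0 < q"
    and closed: "\<And>L N. N \<in> D \<Longrightarrow> divides_mon L N \<Longrightarrow> L \<in> D"
    and vanish: "\<And>L. L \<in> D \<Longrightarrow> eval_mpoly F (\<lambda>i. h (Poly_Mapping.lookup L i)) = 0"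
  shows "lead_mon prec F \<notin> D"
proof
  let ?N = "lead_mon prec F"
  assume N: "?N \<in> D"
  have sub: "{0..Poly_Mapping.lookup ?N i} \<subseteq> {0..<q}" for i
  proof -
    have "Poly_Mapping.lookup ?N i \<le> q - 1"
      using N box by (auto simp: Box_def)
    with q show ?thesis
      by auto
  qed
  have card: "card (h ` {0..Poly_Mapping.lookup ?N i}) = Suc (Poly_Mapping.lookup ?N i)" for i
    using card_image[OF inj_on_subset[OF h sub[of i]]] by simp
  have notdvd: "\<not> divides_mon ?N K" if "K \<in> Supp F" "K \<noteq> ?N" for K
    using lead_mon_exists(2)[OF mo F that] divides_mon_prec[OF mo, of ?N K] that(2)
      prec_trans[OF mo] prec_irrefl[OF mo] by metis
  have "\<exists>x. (\<forall>i. x i \<in> h ` {0..Poly_Mapping.lookup ?N i}) \<and> eval_mpoly F x \<noteq> 0"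
    using nonvanishing_on_grid[OF lead_mon_exists(1)[OF mo F] notdvd _ card] by simp
  then obtain x where x: "\<forall>i. x i \<in> h ` {0..Poly_Mapping.lookup ?N i}" "eval_mpoly F x \<noteq> 0"
    by blast
  have "\<forall>i. \<exists>e. x i = h e \<and> e \<le> Poly_Mapping.lookup ?N i"
  proof
    fix i
    have "x i \<in> h ` {0..Poly_Mapping.lookup ?N i}"
      using x(1) by blast
    then show "\<exists>e. x i = h e \<and> e \<le> Poly_Mapping.lookup ?N i"
      by auto
  qed
  then obtain e where e: "\<forall>i. x i = h (e i) \<and> e i \<le> Poly_Mapping.lookup ?N i"
    using choice[of "\<lambda>i e. x i = h e \<and> e \<le> Poly_Mapping.lookup ?N i"] by blast
  define L where "L = Abs_poly_mapping e"
  have L: "Poly_Mapping.lookup L i = e i" for i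
    by (simp add: L_def)
  have "L \<in> D"
    using closed[OF N, of L] e by (simp add: divides_mon_iff L)
  moreover have "x = (\<lambda>i. h (Poly_Mapping.lookup L i))"
    using e L by auto
  ultimately show False
    using vanish x(2) by simp
qed

lemma exists_sharp_point_set:
  fixes M :: "nat \<Rightarrow> 'x::finite monomial"
  assumes mo: "monomial_ordering prec" and fin: "finite (UNIV :: 'a::field set)"
    and box: "M ` {1..t} \<subseteq> Box CARD('a)"
    and I: "I \<subseteq> {1..t}" "card I = t - k + 1" and k: "1 \<le> k" "k \<le> t"
  shows "\<exists>A :: ('x \<Rightarrow> 'a) set. finite A \<and> card A = mu (M ` I) \<and>
    \<not> (\<exists>F. vanishing_family prec (M ` {1..t}) A k F)"
proof -
  \<comment> \<open>The numbering of the field elements that turns exponent vectors into points.\<close>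
  obtain h where h: "bij_betw h {0..<CARD('a)} (UNIV :: 'a set)"
    using ex_bij_betw_nat_finite[OF fin] by blast
  have q: "0 < CARD('a)"
    using fin by (simp add: card_gt_0_iff)
  define D where "D = {L. \<exists>N\<in>M ` I. divides_mon L N}"
  define p where "p L = (\<lambda>i. h (Poly_Mapping.lookup L i))" for L :: "'x monomial"
  have DBox: "D \<subseteq> Box CARD('a)"
    using box I(1) divides_mon_Box unfolding D_def by blast
  have finD: "finite D"
    using finite_subset[OF DBox finite_Box] .
  have closed: "L \<in> D" if "N \<in> D" "divides_mon L N" for L N
    using that unfolding D_def divides_mon_iff by (blast intro: order_trans)
  have "inj_on p D"
  proof (rule inj_onI)
    fix K L assume KL: "K \<in> D" "L \<in> D" "p K = p L"
    have "Poly_Mapping.lookup K i = Poly_Mapping.lookup L i" for i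
    proof (rule inj_onD[OF bij_betw_imp_inj_on[OF h]])
      show "h (Poly_Mapping.lookup K i) = h (Poly_Mapping.lookup L i)"
        using KL(3) by (metis p_def)
      have "Poly_Mapping.lookup K i \<le> CARD('a) - 1" "Poly_Mapping.lookup L i \<le> CARD('a) - 1"
        using KL(1,2) DBox by (auto simp: Box_def)
      then show "Poly_Mapping.lookup K i \<in> {0..<CARD('a)}" "Poly_Mapping.lookup L i \<in> {0..<CARD('a)}"
        using q by auto
    qed
    then show "K = L"
      by (rule poly_mapping_eqI)
  qed
  then have card: "card (p ` D) = mu (M ` I)"
    by (simp add: card_image mu_def D_def)
  have "\<not> vanishing_family prec (M ` {1..t}) (p ` D) k F" for F :: "nat \<Rightarrow> ('x, 'a) mpoly"
  proof
    assume F: "vanishing_family prec (M ` {1..t}) (p ` D) k F"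
    have "lead_mon prec (F i) \<in> M ` ({1..t} - I)" if i: "i \<in> {1..k}" for i
    proof -
      have "lead_mon prec (F i) \<notin> D"
        using F i
        by (intro lead_mon_not_in_grid[OF mo _ bij_betw_imp_inj_on[OF h] DBox q closed])
          (auto simp: vanishing_family_def p_def)
      moreover have "M ` I \<subseteq> D"
        using divides_mon_refl unfolding D_def by blast
      ultimately show ?thesis
        using F i unfolding vanishing_family_def by blast
    qed
    then have "(\<lambda>i. lead_mon prec (F i)) ` {1..k} \<subseteq> M ` ({1..t} - I)"
      by blast
    then have "card ((\<lambda>i. lead_mon prec (F i)) ` {1..k}) \<le> card (M ` ({1..t} - I))"
      by (intro card_mono) auto
    also have "\<dots> \<le> card ({1..t} - I)"
      by (intro card_image_le) simp
    also have "\<dots> = k - 1"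
      using I k by (subst card_Diff_subset) (auto intro: finite_subset)
    finally show False
      using F k by (simp add: vanishing_family_def card_image)
  qed
  then show ?thesis
    using finD card by (intro exI[of _ "p ` D"]) auto
qed

section \<open>The bound and its sharpness\<close>

theorem theorem5:
  fixes prec :: "'x::finite monomial \<Rightarrow> 'x monomial \<Rightarrow> bool"
    and M :: "nat \<Rightarrow> 'x monomial"
    and t k a :: nat
  assumes "monomial_ordering prec"
    and "\<forall>i\<in>{1..<t}. prec (M i) (M (i + 1))"
    and "infinite (UNIV :: 'a::field set) \<longrightarrow>
          (\<forall>i\<in>{1..<t}. \<not> (\<exists>L. prec (M i) L \<and> prec L (M (i + 1))))"
    and "finite (UNIV :: 'a set) \<longrightarrow>
          M ` {1..t} \<subseteq> Box CARD('a) \<and>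
          (\<forall>i\<in>{1..<t}. \<not> (\<exists>L\<in>Box CARD('a). prec (M i) L \<and> prec L (M (i + 1))))"
    and "1 \<le> k" and "k \<le> t"
    and "a = Min {mu (M ` I) | I. I \<subseteq> {1..t} \<and> card I = t - k + 1}"
  shows "(\<forall>A :: ('x \<Rightarrow> 'a) set. finite A \<and> card A < a \<longrightarrow>
            (\<exists>F :: nat \<Rightarrow> ('x, 'a) mpoly. vanishing_family prec (M ` {1..t}) A k F)) \<and>
         (finite (UNIV :: 'a set) \<longrightarrow>
            (\<forall>A :: ('x \<Rightarrow> 'a) set. finite A \<and> card A < a \<longrightarrow>
              (\<exists>F :: nat \<Rightarrow> ('x, 'a) mpoly. vanishing_family prec (M ` {1..t}) A k F \<and>
                (\<forall>i\<in>{1..k}. Supp (F i) \<subseteq> Box CARD('a)))) \<and>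
            (\<exists>A :: ('x \<Rightarrow> 'a) set. finite A \<and> card A = a \<and>
              \<not> (\<exists>F :: nat \<Rightarrow> ('x, 'a) mpoly. vanishing_family prec (M ` {1..t}) A k F)))"
proof -
  have mono: "prec (M i) (M j)" if "1 \<le> i" "i < j" "j \<le> t" for i j
    using that(2,1,3)
  proof (induction j rule: less_Suc_induct)
    case (1 i)
    then show ?case using assms(2) by auto
  next
    case (2 i j l)
    then show ?case using prec_trans[OF assms(1)] by auto
  qed
  have inj: "inj_on M {1..t}"
    using mono prec_irrefl[OF assms(1)] by (intro linorder_inj_onI) (force, auto)
  let ?V = "{mu (M ` I) | I. I \<subseteq> {1..t} \<and> card I = t - k + 1}"
  have "?V = (\<lambda>I. mu (M ` I)) ` {I \<in> Pow {1..t}. card I = t - k + 1}"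
    by auto
  then have finV: "finite ?V"
    by (rule ssubst) simp
  have "mu (M ` {1..t - k + 1}) \<in> ?V"
    using assms(5,6) by (intro CollectI exI[of _ "{1..t - k + 1}"]) auto
  then have "a \<in> ?V"
    unfolding assms(7) by (intro Min_in finV) blast
  then obtain I where I: "I \<subseteq> {1..t}" "card I = t - k + 1" "a = mu (M ` I)"
    by blast
  have large: "n < mu (M ` I')" if "n < a" "I' \<subseteq> {1..t}" "card I' = t - k + 1" for n I'
  proof -
    have "a \<le> mu (M ` I')"
      unfolding assms(7) using that by (intro Min_le finV) blast
    with that(1) show ?thesis
      by simp
  qed
  have exists: "\<exists>F. vanishing_family prec (M ` {1..t}) A k F \<and> (\<forall>i\<in>{1..k}. Supp (F i) \<subseteq> B)"
    if "reduces_to TYPE('a) B" "M ` {1..t} \<subseteq> B" "finite A" "card A < a"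
    for A :: "('x \<Rightarrow> 'a) set" and B
    using vanishing_family_exists[OF assms(1) that(1,2) inj that(3) assms(6)] large[OF that(4)] by blast
  show ?thesis
  proof (intro conjI impI allI)
    fix A :: "('x \<Rightarrow> 'a) set"
    assume "finite A \<and> card A < a"
    then show "\<exists>F :: nat \<Rightarrow> ('x, 'a) mpoly. vanishing_family prec (M ` {1..t}) A k F"
      using exists[OF reduces_to_UNIV] by blast
  next
    fix A :: "('x \<Rightarrow> 'a) set"
    assume fin: "finite (UNIV :: 'a set)" and "finite A \<and> card A < a"
    then show "\<exists>F :: nat \<Rightarrow> ('x, 'a) mpoly. vanishing_family prec (M ` {1..t}) A k F \<and>
        (\<forall>i\<in>{1..k}. Supp (F i) \<subseteq> Box CARD('a))"
      using exists[OF reduces_to_Box[OF fin]] assms(4) by blast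
  next
    assume fin: "finite (UNIV :: 'a set)"
    then have "M ` {1..t} \<subseteq> Box CARD('a)"
      using assms(4) by blast
    then show "\<exists>A :: ('x \<Rightarrow> 'a) set. finite A \<and> card A = a \<and>
        \<not> (\<exists>F :: nat \<Rightarrow> ('x, 'a) mpoly. vanishing_family prec (M ` {1..t}) A k F)"
      unfolding I(3)
      by (rule exists_sharp_point_set[OF assms(1) fin _ I(1,2) assms(5,6)])
  qed
qed

end
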